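(* Let $R$ be a commutative ring such that not every positive integer is invertible in $R$ (i.e. $R$ does not contain $\mathbb Q$), and let $r_0\geq 1$ be the smallest positive integer that is not invertible in $R$. Let $n\geq r_0$. In $R[x_1,\ldots,x_n]$ let $e_k=\sum_{1\le i_1<\dots<i_k\le n}x_{i_1}\cdots x_{i_k}$ for $1\le k\le n$ and $p_k=\sum_{i=1}^n x_i^k$ for $k\ge1$. Then $$R(e_1,\ldots,e_n)=R(p_1,p_2,\ldots,p_{2n+1-r_0}).$$
   Context: For a commutative ring $R$ and polynomials $f_i\in R[x_1,\ldots,x_n]$ ($i\in I$), $R(f_i\mid i\in I)$ denotes the total ring of fractions $S^{-1}R[f_i\mid i\in I]$ of the subring $R[f_i\mid i\in I]\subseteq R[x_1,\ldots,x_n]$, where $S$ is the multiplicative set of non-zero-divisors of $R[f_i\mid i\in I]$; both sides are regarded inside the total ring of fractions of $R[x_1,\ldots,x_n]$. *)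

theory Defs
  imports Complex_Main "HOL-Library.Poly_Mapping" "HOL-Library.Cardinality"
begin

section \<open>Non-zero-divisors and the total ring of fractions of a commutative ring\<close>

definition nonzerodivisors :: "'a::comm_ring_1 set \<Rightarrow> 'a set" where
  "nonzerodivisors A = {s \<in> A. \<forall>a\<in>A. s * a = 0 \<longrightarrow> a = 0}"

abbreviation regular :: "'a::comm_ring_1 \<Rightarrow> bool" where
  "regular s \<equiv> s \<in> nonzerodivisors UNIV"

lemma regular_iff: "regular s \<longleftrightarrow> (\<forall>a. s * a = 0 \<longrightarrow> a = 0)"
  by (simp add: nonzerodivisors_def)

lemma regular_1 [simp]: "regular 1"
  by (simp add: regular_iff)

lemma regular_mult [simp]: "regular s \<Longrightarrow> regular t \<Longrightarrow> regular (s * t)"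
  unfolding regular_iff by (metis mult.assoc)

lemma regular_cancel: "regular s \<Longrightarrow> s * a = s * b \<longleftrightarrow> a = b"
  unfolding regular_iff by (metis eq_iff_diff_eq_0 right_diff_distrib)

definition totfracrel :: "'a::comm_ring_1 \<times> 'a \<Rightarrow> 'a \<times> 'a \<Rightarrow> bool" where
  "totfracrel x y \<longleftrightarrow>
     regular (snd x) \<and> regular (snd y) \<and> fst x * snd y = fst y * snd x"

lemma part_equivp_totfracrel: "part_equivp (totfracrel :: 'a::comm_ring_1 \<times> 'a \<Rightarrow> _)"
proof (rule part_equivpI)
  show "\<exists>x. totfracrel x x"
    by (rule exI[of _ "(0, 1)"]) (simp add: totfracrel_def)
  show "symp (totfracrel :: 'a \<times> 'a \<Rightarrow> _)"
    by (auto simp: symp_def totfracrel_def)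
  show "transp (totfracrel :: 'a \<times> 'a \<Rightarrow> _)"
  proof (rule transpI)
    fix x y z :: "'a \<times> 'a"
    assume xy: "totfracrel x y" and yz: "totfracrel y z"
    have "snd y * (fst x * snd z) = (fst x * snd y) * snd z"
      by (simp add: ac_simps)
    also have "\<dots> = (fst y * snd x) * snd z"
      using xy by (simp add: totfracrel_def)
    also have "\<dots> = (fst y * snd z) * snd x"
      by (simp add: ac_simps)
    also have "\<dots> = (fst z * snd y) * snd x"
      using yz by (simp add: totfracrel_def)
    also have "\<dots> = snd y * (fst z * snd x)"
      by (simp add: ac_simps)
    finally have "snd y * (fst x * snd z) = snd y * (fst z * snd x)" .
    then show "totfracrel x z"
      using xy yz by (simp add: totfracrel_def regular_cancel)
  qed
qed

quotient_type (overloaded) 'a totfrac = "'a::comm_ring_1 \<times> 'a" / partial: totfracrel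
  by (rule part_equivp_totfracrel)

text \<open>The value of \<^term>\<open>TotFrac a s\<close> is the fraction \<open>a/s\<close> if \<open>s\<close> is a non-zero-divisor;
  otherwise it is the irrelevant default \<open>0\<close>.\<close>

lift_definition TotFrac :: "'a::comm_ring_1 \<Rightarrow> 'a \<Rightarrow> 'a totfrac"
  is "\<lambda>a s. if regular s then (a, s) else (0, 1)"
  by (simp add: totfracrel_def)

lemma TotFrac_cases [cases type: totfrac]:
  obtains (TotFrac) a s where "q = TotFrac a s" "regular s"
  by transfer (auto simp: totfracrel_def split: if_splits)

lemma TotFrac_eq_iff:
  "regular s \<Longrightarrow> regular t \<Longrightarrow> TotFrac a s = TotFrac b t \<longleftrightarrow> a * t = b * s"
  by transfer (simp add: totfracrel_def)

instantiation totfrac :: (comm_ring_1) comm_ring_1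
begin

lift_definition zero_totfrac :: "'a totfrac" is "(0, 1)"
  by (simp add: totfracrel_def)

lift_definition one_totfrac :: "'a totfrac" is "(1, 1)"
  by (simp add: totfracrel_def)

lift_definition plus_totfrac :: "'a totfrac \<Rightarrow> 'a totfrac \<Rightarrow> 'a totfrac"
  is "\<lambda>q r. (fst q * snd r + fst r * snd q, snd q * snd r)"
proof -
  fix x x' y y' :: "'a \<times> 'a"
  assume x: "totfracrel x x'" and y: "totfracrel y y'"
  have "(fst x * snd y + fst y * snd x) * (snd x' * snd y') =
      (fst x * snd x') * (snd y * snd y') + (fst y * snd y') * (snd x * snd x')"
    by (simp add: algebra_simps)
  also have "\<dots> = (fst x' * snd x) * (snd y * snd y') + (fst y' * snd y) * (snd x * snd x')"
    using x y by (simp add: totfracrel_def)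
  also have "\<dots> = (fst x' * snd y' + fst y' * snd x') * (snd x * snd y)"
    by (simp add: algebra_simps)
  finally show "totfracrel (fst x * snd y + fst y * snd x, snd x * snd y)
      (fst x' * snd y' + fst y' * snd x', snd x' * snd y')"
    using x y by (simp add: totfracrel_def)
qed

lift_definition uminus_totfrac :: "'a totfrac \<Rightarrow> 'a totfrac"
  is "\<lambda>q. (- fst q, snd q)"
  by (simp add: totfracrel_def)

definition minus_totfrac :: "'a totfrac \<Rightarrow> 'a totfrac \<Rightarrow> 'a totfrac" where
  "minus_totfrac q r = q + - r"

lift_definition times_totfrac :: "'a totfrac \<Rightarrow> 'a totfrac \<Rightarrow> 'a totfrac"
  is "\<lambda>q r. (fst q * fst r, snd q * snd r)"
proof -
  fix x x' y y' :: "'a \<times> 'a"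
  assume x: "totfracrel x x'" and y: "totfracrel y y'"
  have "(fst x * fst y) * (snd x' * snd y') = (fst x * snd x') * (fst y * snd y')"
    by (simp add: ac_simps)
  also have "\<dots> = (fst x' * snd x) * (fst y' * snd y)"
    using x y by (simp add: totfracrel_def)
  also have "\<dots> = (fst x' * fst y') * (snd x * snd y)"
    by (simp add: ac_simps)
  finally show "totfracrel (fst x * fst y, snd x * snd y) (fst x' * fst y', snd x' * snd y')"
    using x y by (simp add: totfracrel_def)
qed

lemma zero_TotFrac: "0 = TotFrac 0 1"
  by transfer (simp add: totfracrel_def)

lemma one_TotFrac: "1 = TotFrac 1 1"
  by transfer (simp add: totfracrel_def)

lemma add_TotFrac:
  "regular s \<Longrightarrow> regular t \<Longrightarrow> TotFrac a s + TotFrac b t = TotFrac (a * t + b * s) (s * t)"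
  by transfer (simp add: totfracrel_def)

lemma uminus_TotFrac: "- TotFrac a s = TotFrac (- a) s"
  by transfer (simp add: totfracrel_def)

lemma mult_TotFrac:
  "regular s \<Longrightarrow> regular t \<Longrightarrow> TotFrac a s * TotFrac b t = TotFrac (a * b) (s * t)"
  by transfer (simp add: totfracrel_def)

instance
proof
  fix q r s :: "'a totfrac"
  show "(q * r) * s = q * (r * s)"
    by (cases q, cases r, cases s) (simp add: mult_TotFrac ac_simps)
  show "q * r = r * q"
    by (cases q, cases r) (simp add: mult_TotFrac ac_simps)
  show "1 * q = q"
    by (cases q) (simp add: one_TotFrac mult_TotFrac)
  show "(q + r) + s = q + (r + s)"
    by (cases q, cases r, cases s) (simp add: add_TotFrac algebra_simps)
  show "q + r = r + q"
    by (cases q, cases r) (simp add: add_TotFrac ac_simps)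
  show "0 + q = q"
    by (cases q) (simp add: zero_TotFrac add_TotFrac)
  show "- q + q = 0"
    by (cases q) (simp add: zero_TotFrac add_TotFrac uminus_TotFrac TotFrac_eq_iff ac_simps)
  show "q - r = q + - r"
    by (fact minus_totfrac_def)
  show "(q + r) * s = q * s + r * s"
    by (cases q, cases r, cases s)
      (simp add: add_TotFrac mult_TotFrac TotFrac_eq_iff algebra_simps)
  show "(0::'a totfrac) \<noteq> 1"
    by (simp add: zero_TotFrac one_TotFrac TotFrac_eq_iff)
qed

end


section \<open>Polynomials in finitely many variables\<close>

text \<open>The polynomial ring over \<open>'a\<close> in \<open>CARD('n)\<close> variables, indexed by the finite type \<open>'n\<close>;
  the exponent of a monomial is a map from \<open>'n\<close> to the natural numbers.\<close>

type_synonym ('n, 'a) mpoly = "('n \<Rightarrow>\<^sub>0 nat) \<Rightarrow>\<^sub>0 'a"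

definition Const :: "'a::comm_ring_1 \<Rightarrow> ('n, 'a) mpoly" where
  "Const c = Poly_Mapping.single 0 c"

definition Var :: "'n \<Rightarrow> ('n, 'a::comm_ring_1) mpoly" where
  "Var i = Poly_Mapping.single (Poly_Mapping.single i 1) 1"

definition elem_sym :: "nat \<Rightarrow> ('n::finite, 'a::comm_ring_1) mpoly" where
  "elem_sym k = (\<Sum>I | card I = k. \<Prod>i\<in>I. Var i)"

definition power_sum :: "nat \<Rightarrow> ('n::finite, 'a::comm_ring_1) mpoly" where
  "power_sum k = (\<Sum>i\<in>UNIV. Var i ^ k)"


section \<open>The rings \<open>R[f\<^sub>i | i \<in> I]\<close> and \<open>R(f\<^sub>i | i \<in> I)\<close>\<close>

text \<open>Closure under negation follows from the constant \<open>-1\<close>.\<close>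

inductive_set adjoin :: "('n::finite, 'a::comm_ring_1) mpoly set \<Rightarrow> ('n, 'a) mpoly set"
  for F :: "('n, 'a) mpoly set"
where
  Const: "Const c \<in> adjoin F"
| gen: "f \<in> F \<Longrightarrow> f \<in> adjoin F"
| add: "f \<in> adjoin F \<Longrightarrow> g \<in> adjoin F \<Longrightarrow> f + g \<in> adjoin F"
| mult: "f \<in> adjoin F \<Longrightarrow> g \<in> adjoin F \<Longrightarrow> f * g \<in> adjoin F"

text \<open>The denominators are the non-zero-divisors of the subring \<^term>\<open>adjoin F\<close> itself. By
  \<open>nonzerodivisors_adjoin\<close> below they are non-zero-divisors of the whole polynomial
  ring, so every \<^term>\<open>TotFrac a s\<close> occurring here is a genuine fraction, and equality of
  such fractions agrees with equality in the total ring of fractions of \<^term>\<open>adjoin F\<close>.\<close>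

definition adjoin_frac ::
  "('n::finite, 'a::comm_ring_1) mpoly set \<Rightarrow> ('n, 'a) mpoly totfrac set" where
  "adjoin_frac F = {TotFrac a s | a s. a \<in> adjoin F \<and> s \<in> nonzerodivisors (adjoin F)}"


subsection \<open>McCoy's theorem\<close>

lemma lookup_Const_mult:
  "Poly_Mapping.lookup (Const c * f) m = c * Poly_Mapping.lookup f m"
  unfolding Const_def mult_map_scale_conv_mult[symmetric]
  by (simp add: Poly_Mapping.map.rep_eq when_def)

lemma monomial_order:
  obtains \<phi> :: "('n::finite \<Rightarrow>\<^sub>0 nat) \<Rightarrow> (nat \<Rightarrow>\<^sub>0 nat)"
  where "inj \<phi>" "\<And>a b. \<phi> (a + b) = \<phi> a + \<phi> b"
proof -
  obtain h :: "'n \<Rightarrow> nat" where h: "inj h"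
    using finite_imp_inj_to_nat_seg[OF finite, of "UNIV :: 'n set"] by blast
  define \<phi> :: "('n \<Rightarrow>\<^sub>0 nat) \<Rightarrow> (nat \<Rightarrow>\<^sub>0 nat)"
    where "\<phi> m = (\<Sum>i\<in>UNIV. Poly_Mapping.single (h i) (Poly_Mapping.lookup m i))" for m
  have lookup_\<phi>: "Poly_Mapping.lookup (\<phi> m) (h i) = Poly_Mapping.lookup m i" for m i
    using h by (simp add: \<phi>_def lookup_sum lookup_single when_def inj_eq)
  have "inj \<phi>"
  proof (rule injI)
    fix a b assume "\<phi> a = \<phi> b"
    then have "Poly_Mapping.lookup a i = Poly_Mapping.lookup b i" for i
      using lookup_\<phi>[of a i] lookup_\<phi>[of b i] by simp
    then show "a = b"
      by (rule poly_mapping_eqI)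
  qed
  moreover have "\<phi> (a + b) = \<phi> a + \<phi> b" for a b
    by (simp add: \<phi>_def lookup_add single_add sum.distrib)
  ultimately show thesis
    by (rule that)
qed

lemma ex_arg_max:
  fixes \<phi> :: "'b \<Rightarrow> 'c::linorder"
  assumes "finite A" "A \<noteq> {}"
  obtains m where "m \<in> A" "\<forall>a\<in>A. \<phi> a \<le> \<phi> m"
proof -
  have "Max (\<phi> ` A) \<in> \<phi> ` A"
    using assms by (intro Max_in) auto
  then obtain m where "m \<in> A" "\<phi> m = Max (\<phi> ` A)"
    by auto
  then show thesis
    using assms by (intro that[of m]) auto
qed

lemma McCoy:
  fixes f g :: "('n::finite, 'a::comm_ring_1) mpoly"
  assumes "f * g = 0" "g \<noteq> 0"
  shows "\<exists>c. c \<noteq> 0 \<and> Const c * f = 0"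
  using assms
proof (induction "card (Poly_Mapping.keys g)" arbitrary: g rule: less_induct)
  case less
  obtain \<phi> :: "('n \<Rightarrow>\<^sub>0 nat) \<Rightarrow> (nat \<Rightarrow>\<^sub>0 nat)"
    where inj: "inj \<phi>" and \<phi>_add: "\<And>a b. \<phi> (a + b) = \<phi> a + \<phi> b"
    using monomial_order by blast
  define F G where "F = Poly_Mapping.lookup f" and "G = Poly_Mapping.lookup g"
  define M where "M = {m \<in> Poly_Mapping.keys f. Const (F m) * g \<noteq> 0}"
  have kg: "Poly_Mapping.keys g \<noteq> {}"
    using less.prems by simp
  have not_M: "F a * G b = 0" if "a \<notin> M" for a b
  proof (cases "a \<in> Poly_Mapping.keys f")
    case True
    with that have "Const (F a) * g = 0"
      by (simp add: M_def)
    then show ?thesis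
      using lookup_Const_mult[of "F a" g b] by (simp add: G_def)
  next
    case False
    then show ?thesis
      by (simp add: F_def in_keys_iff)
  qed
  show ?case
  proof (cases "M = {}")
    case True
    obtain l where l: "G l \<noteq> 0"
      using kg unfolding G_def by (meson all_not_in_conv in_keys_iff)
    have "Const (G l) * f = 0"
    proof (rule poly_mapping_eqI)
      fix m
      have "G l * Poly_Mapping.lookup f m = Poly_Mapping.lookup f m * G l"
        by (rule mult.commute)
      also have "\<dots> = 0"
        using not_M[of m l] True unfolding F_def by blast
      finally show "Poly_Mapping.lookup (Const (G l) * f) m = Poly_Mapping.lookup 0 m"
        by (simp only: lookup_Const_mult lookup_zero)
    qed
    with l show ?thesis
      by blast
  next
    case False
    have "finite M"
      by (simp add: M_def)
    from ex_arg_max[OF this False, of \<phi>]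
    obtain m where m: "m \<in> M" "\<forall>a\<in>M. \<phi> a \<le> \<phi> m" .
    from ex_arg_max[OF finite_keys kg, of \<phi>]
    obtain l where l: "l \<in> Poly_Mapping.keys g" "\<forall>b\<in>Poly_Mapping.keys g. \<phi> b \<le> \<phi> l" .
    have other: "F a * G b = 0" if ab: "m + l = a + b" and "a \<noteq> m" for a b
    proof (cases "a \<in> M \<and> b \<in> Poly_Mapping.keys g")
      case True
      then have le: "\<phi> a \<le> \<phi> m" "\<phi> b \<le> \<phi> l"
        using m(2) l(2) by blast+
      have "\<phi> a \<noteq> \<phi> m"
        using inj \<open>a \<noteq> m\<close> by (simp add: inj_eq)
      then have "\<phi> a < \<phi> m"
        using le(1) by (rule le_neq_trans[rotated])
      then have "\<phi> a + \<phi> b < \<phi> m + \<phi> l"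
        using le(2) by (rule add_less_le_mono)
      moreover have "\<phi> m + \<phi> l = \<phi> a + \<phi> b"
        using ab \<phi>_add[of m l] \<phi>_add[of a b] by simp
      ultimately show ?thesis
        by simp
    next
      case False
      then show ?thesis
        using not_M by (auto simp: G_def in_keys_iff)
    qed
    have "F a * (\<Sum>q. G q when m + l = a + q) = (F m * G l when a = m)" for a
    proof (cases "\<exists>b. m + l = a + b")
      case True
      then obtain b where b: "m + l = a + b"
        by blast
      have "(m + l = a + q) \<longleftrightarrow> q = b" for q
        unfolding b by auto
      then have "(\<Sum>q. G q when m + l = a + q) = G b"
        by simp
      moreover have "F a * G b = (F m * G l when a = m)"
        using other[OF b] b by (cases "a = m") auto
      ultimately show ?thesis
        by simp
    next
      case False
      then have "(G q when m + l = a + q) = 0" and "a \<noteq> m" for q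
        by auto
      then show ?thesis
        by simp
    qed
    then have "Poly_Mapping.lookup (f * g) (m + l) = F m * G l"
      by (simp add: lookup_mult F_def G_def)
    then have FG: "F m * G l = 0"
      using less.prems by simp
    define g' where "g' = Const (F m) * g"
    have "g' \<noteq> 0"
      using m by (simp add: g'_def M_def)
    moreover have "f * g' = 0"
      using less.prems by (simp add: g'_def mult.left_commute[of f "Const (F m)" g])
    moreover have "card (Poly_Mapping.keys g') < card (Poly_Mapping.keys g)"
    proof (rule psubset_card_mono)
      have "l \<notin> Poly_Mapping.keys g'"
        using FG by (simp add: g'_def in_keys_iff lookup_Const_mult G_def)
      moreover have "Poly_Mapping.keys g' \<subseteq> Poly_Mapping.keys g"
        by (auto simp: g'_def in_keys_iff lookup_Const_mult)
      ultimately show "Poly_Mapping.keys g' \<subset> Poly_Mapping.keys g"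
        using l by blast
    qed simp
    ultimately show ?thesis
      using less.hyps by blast
  qed
qed

lemma nonzerodivisors_adjoin: "s \<in> nonzerodivisors (adjoin F) \<Longrightarrow> regular s"
proof (rule ccontr)
  assume s: "s \<in> nonzerodivisors (adjoin F)" and "\<not> regular s"
  then obtain g where "s * g = 0" "g \<noteq> 0"
    by (auto simp: regular_iff)
  then obtain c where c: "c \<noteq> 0" "Const c * s = 0"
    using McCoy by blast
  have "s * Const c = 0"
    using c by (simp only: mult.commute)
  then have "Const c = (0 :: ('a, 'b) mpoly)"
    using s adjoin.Const[of c F] by (auto simp: nonzerodivisors_def)
  then have "Poly_Mapping.lookup (Const c :: ('a, 'b) mpoly) 0 = 0"
    by (simp only: lookup_zero)
  then have "c = 0"
    by (simp only: Const_def lookup_single_eq)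
  with c show False
    by simp
qed

end

theory Submission
  imports Defs "Jordan_Normal_Form.Determinant"
begin

text \<open>Newton's identities express the power sums in the elementary symmetric polynomials. Conversely,
  they give \<open>e\<^sub>k\<close> for \<open>k < r\<^sub>0\<close>, because \<open>k\<close> is then invertible. The identities of degrees
  \<open>n + 1, \<dots>, 2 n + 1 - r\<^sub>0\<close>, in which no integer coefficients occur, form a square linear system for
  the other \<open>e\<^sub>k\<close>. Its matrix is the Hankel matrix of the power sums, whose determinant has a
  coefficient 1, so that it is a non-zero-divisor by McCoy's theorem; by Cramer's rule it is a
  common denominator of all \<open>e\<^sub>k\<close>.\<close>

section \<open>Newton's identities\<close>

text \<open>This is \<open>Var i\<close> times the partial derivative of \<open>elem_sym k\<close>
  with respect to \<open>Var i\<close>; summing over \<open>i\<close> will give Euler's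
  relation.\<close>

definition elem_sym_through :: "'n::finite \<Rightarrow> nat \<Rightarrow> ('n, 'a::comm_ring_1) mpoly" where
  "elem_sym_through i k = (\<Sum>I | card I = k \<and> i \<in> I. \<Prod>j\<in>I. Var j)"

lemma elem_sym_0: "elem_sym 0 = 1"
proof -
  have "{I::'n::finite set. card I = 0} = {{}}"
    by auto
  then show ?thesis
    by (simp add: elem_sym_def)
qed

lemma elem_sym_eq_0:
  assumes "k > CARD('n::finite)"
  shows "(elem_sym k :: ('n, 'a::comm_ring_1) mpoly) = 0"
proof -
  have "card I \<noteq> k" for I :: "'n set"
    using card_mono[of UNIV I] assms by auto
  then show ?thesis
    by (simp add: elem_sym_def)
qed

lemma elem_sym_through_0: "elem_sym_through i 0 = 0"
proof -
  have "{I. card I = 0 \<and> i \<in> I} = {}"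
    by auto
  then show ?thesis
    by (simp only: elem_sym_through_def sum.empty)
qed

text \<open>Removing \<open>i\<close> is a bijection from the sets of size \<open>Suc k\<close>
  containing \<open>i\<close> to the sets of size \<open>k\<close> avoiding
  \<open>i\<close>.\<close>

lemma elem_sym_through_Suc:
  "elem_sym_through i (Suc k) =
    Var i * (elem_sym k - elem_sym_through i k :: ('n::finite, 'a::comm_ring_1) mpoly)"
proof -
  have "(elem_sym k :: ('n, 'a) mpoly) = elem_sym_through i k + (\<Sum>I | card I = k \<and> i \<notin> I. \<Prod>j\<in>I. Var j)"
    unfolding elem_sym_def elem_sym_through_def
    by (subst sum.union_disjoint[symmetric]) (auto intro!: sum.cong)
  then have "(elem_sym k :: ('n, 'a) mpoly) - elem_sym_through i k =
      (\<Sum>I | card I = k \<and> i \<notin> I. \<Prod>j\<in>I. Var j)"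
    by (simp only: add_diff_cancel_left')
  then have "Var i * (elem_sym k - elem_sym_through i k :: ('n, 'a) mpoly) =
      (\<Sum>I | card I = k \<and> i \<notin> I. Var i * (\<Prod>j\<in>I. Var j))"
    by (simp only: sum_distrib_left)
  also have "\<dots> = elem_sym_through i (Suc k)"
    unfolding elem_sym_through_def
    by (rule sum.reindex_bij_witness[of _ "\<lambda>I. I - {i}" "insert i"]) auto
  finally show ?thesis ..
qed

lemma elem_sym_through_eq:
  "elem_sym_through i k = (\<Sum>j<k. (- 1) ^ j * elem_sym (k - 1 - j) * Var i ^ Suc j)"
proof (induction k)
  case 0
  show ?case
    by (simp add: elem_sym_through_0)
next
  case (Suc k)
  have "(\<Sum>j<Suc k. (- 1) ^ j * elem_sym (Suc k - 1 - j) * Var i ^ Suc j) =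
      Var i * elem_sym k - Var i * (\<Sum>j<k. (- 1) ^ j * elem_sym (k - 1 - j) * Var i ^ Suc j)"
    unfolding sum.lessThan_Suc_shift sum_distrib_left
    by (simp add: sum_negf algebra_simps)
  then show ?case
    unfolding elem_sym_through_Suc Suc.IH right_diff_distrib by (rule sym)
qed

text \<open>Double counting: the monomial of a set \<open>I\<close> of size \<open>k\<close> is
  counted once for each of its \<open>k\<close> elements.\<close>

lemma sum_elem_sym_through:
  "(\<Sum>i\<in>UNIV. elem_sym_through i k) = of_nat k * (elem_sym k :: ('n::finite, 'a::comm_ring_1) mpoly)"
proof -
  have "(\<Sum>i\<in>UNIV. elem_sym_through i k) =
      (\<Sum>i\<in>UNIV. \<Sum>I | I \<in> {I. card I = k} \<and> i \<in> I. \<Prod>j\<in>I. Var j :: ('n, 'a) mpoly)"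
    by (simp add: elem_sym_through_def)
  also have "\<dots> = (\<Sum>I | card I = k. \<Sum>i | i \<in> UNIV \<and> i \<in> I. \<Prod>j\<in>I. Var j)"
    by (rule sum.swap_restrict) auto
  also have "\<dots> = of_nat k * elem_sym k"
    by (simp add: elem_sym_def sum_distrib_left)
  finally show ?thesis .
qed

theorem newton_identity:
  "of_nat k * (elem_sym k :: ('n::finite, 'a::comm_ring_1) mpoly) =
     (\<Sum>j<k. (- 1) ^ j * elem_sym (k - 1 - j) * power_sum (Suc j))"
proof -
  have "of_nat k * (elem_sym k :: ('n, 'a) mpoly) =
      (\<Sum>i\<in>UNIV. \<Sum>j<k. (- 1) ^ j * elem_sym (k - 1 - j) * Var i ^ Suc j)"
    by (simp only: sum_elem_sym_through[symmetric] elem_sym_through_eq)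
  also have "\<dots> = (\<Sum>j<k. (- 1) ^ j * elem_sym (k - 1 - j) * power_sum (Suc j))"
    unfolding power_sum_def sum_distrib_left by (rule sum.swap)
  finally show ?thesis .
qed

text \<open>Here \<open>elem_sym m\<close> vanishes, and with it the only integer coefficient of the
  identity; what remains is a linear relation valid over every commutative ring.\<close>

lemma newton_identity_above:
  assumes "m > CARD('n::finite)"
  shows "(\<Sum>j\<le>CARD('n). (- 1) ^ j * elem_sym j * power_sum (m - j)) = (0 :: ('n, 'a::comm_ring_1) mpoly)"
proof -
  have "0 = (\<Sum>j<m. (- 1) ^ j * elem_sym (m - 1 - j) * (power_sum (Suc j) :: ('n, 'a) mpoly))"
    using newton_identity[where ?'n = 'n and ?'a = 'a, of m] elem_sym_eq_0[OF assms, where ?'a = 'a] by simp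
  also have "\<dots> = (\<Sum>j<m. (- 1) ^ (m - 1 - j) * elem_sym j * power_sum (m - j))"
    by (rule sum.reindex_bij_witness[of _ "\<lambda>j. m - 1 - j" "\<lambda>j. m - 1 - j"]) (auto simp: Suc_diff_Suc)
  also have "\<dots> = (- 1) ^ (m - 1) * (\<Sum>j<m. (- 1) ^ j * elem_sym j * power_sum (m - j))"
    unfolding sum_distrib_left
  proof (rule sum.cong)
    fix j assume "j \<in> {..<m}"
    then have "m - 1 = (m - 1 - j) + j"
      by simp
    then have "(- 1) ^ (m - 1) = (- 1) ^ (m - 1 - j) * (- 1 :: ('n, 'a) mpoly) ^ j"
      by (metis power_add)
    then show "(- 1) ^ (m - 1 - j) * elem_sym j * power_sum (m - j) =
        (- 1) ^ (m - 1) * ((- 1) ^ j * elem_sym j * (power_sum (m - j) :: ('n, 'a) mpoly))"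
      by (simp add: mult.assoc left_minus_one_mult_self power_mult_distrib[symmetric])
  qed simp
  \<comment> \<open>The global sign is its own inverse, so multiplying by it once more cancels
    it.\<close>
  finally have "(- 1) ^ (m - 1) * 0 =
      (- 1) ^ (m - 1) * ((- 1) ^ (m - 1) * (\<Sum>j<m. (- 1) ^ j * elem_sym j * (power_sum (m - j) :: ('n, 'a) mpoly)))"
    by (rule arg_cong)
  then have "(\<Sum>j<m. (- 1) ^ j * elem_sym j * (power_sum (m - j) :: ('n, 'a) mpoly)) = 0"
    by (simp only: left_minus_one_mult_self mult_zero_right)
  moreover have "(\<Sum>j\<le>CARD('n). (- 1) ^ j * elem_sym j * (power_sum (m - j) :: ('n, 'a) mpoly)) =
      (\<Sum>j<m. (- 1) ^ j * elem_sym j * power_sum (m - j))"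
    using assms by (intro sum.mono_neutral_left) (auto simp: elem_sym_eq_0)
  ultimately show ?thesis
    by simp
qed


section \<open>Subrings generated by polynomials\<close>

lemma Const_simps: "Const 0 = 0" "Const 1 = 1" "Const (- c) = - Const c"
  "Const (c * d) = Const c * Const d" "Const (of_nat k) = of_nat k"
  by (simp_all add: Const_def mult_single single_uminus)

lemma adjoin_0: "0 \<in> adjoin F" and adjoin_1: "1 \<in> adjoin F"
  using adjoin.Const[of 0 F] adjoin.Const[of 1 F] by (simp_all add: Const_simps)

lemma adjoin_uminus: "f \<in> adjoin F \<Longrightarrow> - f \<in> adjoin F"
  using adjoin.mult[OF adjoin.Const[of "- 1"], of f F] by (simp add: Const_simps)

lemma adjoin_sum: "(\<And>i. i \<in> A \<Longrightarrow> f i \<in> adjoin F) \<Longrightarrow> sum f A \<in> adjoin F"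
  by (induction A rule: infinite_finite_induct) (auto intro: adjoin.add adjoin_0)

lemma adjoin_prod: "(\<And>i. i \<in> A \<Longrightarrow> f i \<in> adjoin F) \<Longrightarrow> prod f A \<in> adjoin F"
  by (induction A rule: infinite_finite_induct) (auto intro: adjoin.mult adjoin_1)

lemma adjoin_power: "f \<in> adjoin F \<Longrightarrow> f ^ k \<in> adjoin F"
  by (induction k) (auto intro: adjoin.mult adjoin_1)

lemma adjoin_minus_1_power: "(- 1) ^ k \<in> adjoin F"
  by (intro adjoin_power adjoin_uminus adjoin_1)

lemma adjoin_signof: "signof p \<in> adjoin F"
  by (auto simp: sign_def adjoin_1 adjoin_uminus)

section \<open>Cramer's rule over a subring\<close>

lemma adjoin_det:
  assumes "A \<in> carrier_mat n n" "\<And>i j. i < n \<Longrightarrow> j < n \<Longrightarrow> A $$ (i, j) \<in> adjoin F"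
  shows "det A \<in> adjoin F"
  unfolding det_def'[OF assms(1)]
  by (intro adjoin_sum adjoin.mult adjoin_prod adjoin_signof assms(2)) auto

lemma adjoin_adj_mat:
  assumes A: "A \<in> carrier_mat n n" and F: "\<And>i j. i < n \<Longrightarrow> j < n \<Longrightarrow> A $$ (i, j) \<in> adjoin F"
    and ij: "i < n" "j < n"
  shows "adj_mat A $$ (i, j) \<in> adjoin F"
proof -
  have "det (mat_delete A j i) \<in> adjoin F"
    using A ij
    by (intro adjoin_det[OF mat_delete_carrier[OF A]])
      (auto simp: mat_delete_def intro!: F split: if_splits)
  then show ?thesis
    using A ij by (auto simp: adj_mat_def cofactor_def intro!: adjoin.mult adjoin_minus_1_power)
qed

text \<open>Multiply \<open>A *\<^sub>v v\<close> by the adjugate, whose entries stay in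
  \<open>adjoin F\<close>. The entries of \<open>v\<close> may lie outside, as the unknown
  \<open>elem_sym j\<close> will.\<close>

lemma adjoin_det_mult:
  assumes A: "A \<in> carrier_mat n n" and v: "v \<in> carrier_vec n"
    and F: "\<And>i j. i < n \<Longrightarrow> j < n \<Longrightarrow> A $$ (i, j) \<in> adjoin F"
    and Av: "\<And>i. i < n \<Longrightarrow> (A *\<^sub>v v) $ i \<in> adjoin F"
    and i: "i < n"
  shows "det A * v $ i \<in> adjoin F"
proof -
  note adj = adj_mat[OF A]
  have "det A * v $ i = ((det A \<cdot>\<^sub>m 1\<^sub>m n) *\<^sub>v v) $ i"
    using v i by simp
  also have "\<dots> = (adj_mat A *\<^sub>v (A *\<^sub>v v)) $ i"
    unfolding adj(3)[symmetric] by (simp only: assoc_mult_mat_vec[OF adj(1) A v])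
  also have "\<dots> = (\<Sum>j\<in>{0..<n}. adj_mat A $$ (i, j) * (A *\<^sub>v v) $ j)"
    using A adj(1) i by (simp add: scalar_prod_def)
  also have "\<dots> \<in> adjoin F"
    by (intro adjoin_sum adjoin.mult adjoin_adj_mat[OF A F] Av i) auto
  finally show ?thesis .
qed

section \<open>Clearing denominators\<close>

lemma adjoin_denominator:
  assumes "f \<in> adjoin G" "d \<in> adjoin F" and G: "\<And>g. g \<in> G \<Longrightarrow> d * g \<in> adjoin F"
  shows "\<exists>k. d ^ k * f \<in> adjoin F"
  using assms(1)
proof induction
  case (Const c)
  then show ?case
    by (intro exI[of _ 0]) (simp add: adjoin.Const)
next
  case (gen f)
  then show ?case
    by (intro exI[of _ 1]) (simp add: G)
next
  case (add f g)
  then obtain k l where k: "d ^ k * f \<in> adjoin F" and l: "d ^ l * g \<in> adjoin F"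
    by blast
  note mult_power = adjoin.mult[OF adjoin_power[OF assms(2)]]
  have "d ^ l * (d ^ k * f) + d ^ k * (d ^ l * g) \<in> adjoin F"
    by (rule adjoin.add[OF mult_power[OF k] mult_power[OF l]])
  then show ?case
    by (intro exI[of _ "k + l"]) (simp add: power_add algebra_simps)
next
  case (mult f g)
  then obtain k l where "d ^ k * f \<in> adjoin F" "d ^ l * g \<in> adjoin F"
    by blast
  then have "(d ^ k * f) * (d ^ l * g) \<in> adjoin F"
    by (rule adjoin.mult)
  then show ?case
    by (intro exI[of _ "k + l"]) (simp add: power_add algebra_simps)
qed

lemma adjoin_subset: "F \<subseteq> adjoin G \<Longrightarrow> adjoin F \<subseteq> adjoin G"
proof
  fix f assume "F \<subseteq> adjoin G" "f \<in> adjoin F"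
  from this(2,1) show "f \<in> adjoin G"
    by induction (auto intro: adjoin.intros)
qed

text \<open>By McCoy's theorem regularity does not depend on the subring, so denominators can be
  carried from one subring to another.\<close>

lemma nonzerodivisors_adjoin_iff:
  "s \<in> nonzerodivisors (adjoin F) \<longleftrightarrow> s \<in> adjoin F \<and> regular s"
proof
  assume "s \<in> nonzerodivisors (adjoin F)"
  then show "s \<in> adjoin F \<and> regular s"
    by (simp add: nonzerodivisors_adjoin) (simp add: nonzerodivisors_def)
next
  assume "s \<in> adjoin F \<and> regular s"
  then show "s \<in> nonzerodivisors (adjoin F)"
    by (simp add: nonzerodivisors_def)
qed

lemma adjoin_frac_eqI:
  assumes "F \<subseteq> adjoin G" and d: "d \<in> adjoin F" "regular d"
    and G: "\<And>g. g \<in> G \<Longrightarrow> d * g \<in> adjoin F"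
  shows "adjoin_frac G = adjoin_frac F"
proof (rule antisym)
  show "adjoin_frac F \<subseteq> adjoin_frac G"
    using adjoin_subset[OF assms(1)] by (auto simp: adjoin_frac_def nonzerodivisors_adjoin_iff)
  show "adjoin_frac G \<subseteq> adjoin_frac F"
  proof
    fix q assume "q \<in> adjoin_frac G"
    then obtain a s where q: "q = TotFrac a s" and a: "a \<in> adjoin G" and s: "s \<in> adjoin G" "regular s"
      by (auto simp: adjoin_frac_def nonzerodivisors_adjoin_iff)
    obtain k l where k: "d ^ k * a \<in> adjoin F" and l: "d ^ l * s \<in> adjoin F"
      using adjoin_denominator[OF a d(1) G] adjoin_denominator[OF s(1) d(1) G] by blast
    have regular_power: "regular (d ^ m)" for m
      by (induction m) (simp_all add: d(2))
    \<comment> \<open>The fraction is expanded by \<open>d ^ (k + l)\<close>, enough to clear both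
      numerator and denominator.\<close>
    have "q = TotFrac (d ^ l * (d ^ k * a)) (d ^ k * (d ^ l * s))"
      unfolding q using s(2) by (simp add: TotFrac_eq_iff regular_power ac_simps)
    moreover have "d ^ l * (d ^ k * a) \<in> adjoin F" "d ^ k * (d ^ l * s) \<in> adjoin F"
      by (intro adjoin.mult adjoin_power d(1) k l)+
    moreover have "regular (d ^ k * (d ^ l * s))"
      by (intro regular_mult regular_power s(2))
    ultimately show "q \<in> adjoin_frac F"
      by (auto simp: adjoin_frac_def nonzerodivisors_adjoin_iff)
  qed
qed


section \<open>The Hankel determinant of the power sums\<close>

lemma lookup_sum_single_inj_on:
  assumes "finite U" "inj_on f U" "i \<in> U"
  shows "Poly_Mapping.lookup (\<Sum>j\<in>U. Poly_Mapping.single (f j) (k j)) (f i) = k i"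
proof -
  have "Poly_Mapping.lookup (\<Sum>j\<in>U. Poly_Mapping.single (f j) (k j)) (f i) =
      (\<Sum>j\<in>U. if j = i then k j else 0)"
    unfolding lookup_sum using assms(2,3)
    by (intro sum.cong) (auto simp: lookup_single when_def inj_on_eq_iff)
  then show ?thesis
    using assms(1,3) by simp
qed

lemma keys_sum_single:
  fixes k :: "'i \<Rightarrow> nat"
  assumes "finite U" "\<And>i. i \<in> U \<Longrightarrow> k i > 0"
  shows "Poly_Mapping.keys (\<Sum>j\<in>U. Poly_Mapping.single (f j) (k j)) = f ` U"
proof -
  have "(\<Sum>j\<in>U. k j when f j = l) = 0 \<longleftrightarrow> l \<notin> f ` U" for l
    using assms(1) by (force simp: when_def dest: assms(2))
  then show ?thesis
    by (auto simp: in_keys_iff lookup_sum lookup_single)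
qed

text \<open>The parallelogram law turns \<open>i + p i = 2 t i\<close> into \<open>\<Sum>i. (i - p i)\<^sup>2 = 0\<close>.\<close>

lemma permutes_id_if_sum_even:
  assumes p: "p permutes U" and t: "bij_betw t U U" and "finite U"
    and eq: "\<And>i. i \<in> U \<Longrightarrow> i + p i = 2 * t i"
  shows "p = (id :: nat \<Rightarrow> nat)"
proof -
  define q where "q i = (int i)\<^sup>2" for i
  have "(\<Sum>i\<in>U. (int i - int (p i))\<^sup>2) = (\<Sum>i\<in>U. 2 * q i + 2 * q (p i) - 4 * q (t i))"
  proof (rule sum.cong)
    fix i assume "i \<in> U"
    then have *: "int (p i) = 2 * int (t i) - int i"
      using eq[of i] by linarith
    show "(int i - int (p i))\<^sup>2 = 2 * q i + 2 * q (p i) - 4 * q (t i)"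
      unfolding q_def * by (simp add: power2_eq_square algebra_simps)
  qed simp
  also have "\<dots> = 2 * (\<Sum>i\<in>U. q i) + 2 * (\<Sum>i\<in>U. q (p i)) - 4 * (\<Sum>i\<in>U. q (t i))"
    by (simp add: sum.distrib sum_subtractf sum_distrib_left)
  \<comment> \<open>Both \<open>p\<close> and \<open>t\<close> permute \<open>U\<close>, so the
    three sums of squares agree and 2 + 2 - 4 = 0.\<close>
  also have "\<dots> = 0"
    using sum.reindex_bij_betw[OF t, of q] sum.reindex_bij_betw[OF permutes_imp_bij[OF p], of q] by simp
  finally have "\<forall>i\<in>U. (int i - int (p i))\<^sup>2 = 0"
    using \<open>finite U\<close> by (subst (asm) sum_nonneg_eq_0_iff) auto
  then have "p i = i" for i
    using p by (cases "i \<in> U") (auto simp: permutes_def)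
  then show ?thesis
    by auto
qed

text \<open>All exponents are positive, so both monomials involve the same variables. There are
  \<open>N\<close> of them, hence \<open>f\<close> is injective and equals \<open>h\<close> composed
  with a permutation \<open>t\<close>. Comparing exponents of \<open>f i\<close> gives
  \<open>i + p i = 2 * t i\<close>, which forces \<open>p = id\<close> and then
  \<open>t i = i\<close>.\<close>

lemma hankel_monomial_unique:
  fixes f h :: "nat \<Rightarrow> 'n"
  assumes p: "p permutes {0..<N}" and h: "inj_on h {0..<N}"
    and eq: "(\<Sum>i\<in>{0..<N}. Poly_Mapping.single (f i) (Suc (i + p i))) =
      (\<Sum>i\<in>{0..<N}. Poly_Mapping.single (h i) (Suc (2 * i)))"
  shows "p = id \<and> (\<forall>i\<in>{0..<N}. f i = h i)"
proof -
  define U where "U = {0..<N}"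
  have U: "finite U"
    by (simp add: U_def)
  note h = h[folded U_def] and eq = eq[folded U_def] and p = p[folded U_def]
  have im: "f ` U = h ` U"
    using keys_sum_single[OF U, of "\<lambda>i. Suc (i + p i)" f] keys_sum_single[OF U, of "\<lambda>i. Suc (2 * i)" h] eq
    by simp
  then have "card (f ` U) = card U"
    using h by (simp add: card_image)
  then have f: "inj_on f U"
    using U by (simp add: eq_card_imp_inj_on)
  have "\<forall>i\<in>U. \<exists>j\<in>U. f i = h j"
    using im by blast
  then obtain t where t: "\<And>i. i \<in> U \<Longrightarrow> t i \<in> U" "\<And>i. i \<in> U \<Longrightarrow> f i = h (t i)"
    by metis
  have "inj_on t U"
    using f t by (auto simp: inj_on_def)
  moreover from this have "t ` U = U"
    using t(1) by (intro endo_inj_surj U) auto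
  ultimately have bij: "bij_betw t U U"
    by (simp add: bij_betw_def)
  have pt: "i + p i = 2 * t i" if "i \<in> U" for i
    using lookup_sum_single_inj_on[OF U f that, of "\<lambda>i. Suc (i + p i)"]
      lookup_sum_single_inj_on[OF U h t(1)[OF that], of "\<lambda>i. Suc (2 * i)"] eq t(2)[OF that]
    by simp
  then have "p = id"
    by (intro permutes_id_if_sum_even[OF p bij U])
  moreover from this have "t i = i" if "i \<in> U" for i
    using pt[OF that] by simp
  ultimately show ?thesis
    using t(2) by (simp add: U_def)
qed

lemma Var_power: "Var i ^ k = Poly_Mapping.single (Poly_Mapping.single i k) 1"
  by (induction k) (simp_all add: Var_def mult_single single_add[symmetric] single_one[symmetric] del: single_one)

lemma prod_single_1:
  "(\<Prod>i\<in>A. Poly_Mapping.single (m i) 1) =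
    (Poly_Mapping.single (\<Sum>i\<in>A. m i) 1 :: ('b::comm_monoid_add \<Rightarrow>\<^sub>0 'a::comm_ring_1))"
  by (induction A rule: infinite_finite_induct) (simp_all add: mult_single)

text \<open>A non-zero constant annihilating \<open>f\<close>, as McCoy's theorem would supply,
  would annihilate the coefficient 1.\<close>

lemma regular_if_coeff_1:
  assumes "Poly_Mapping.lookup f m = 1"
  shows "regular (f :: ('n::finite, 'a::comm_ring_1) mpoly)"
proof (rule ccontr)
  assume "\<not> regular f"
  then obtain c where "c \<noteq> 0" "Const c * f = 0"
    using McCoy by (auto simp: regular_iff)
  then show False
    using lookup_Const_mult[of c f m] assms by simp
qed

definition hankel :: "nat \<Rightarrow> ('n::finite, 'a::comm_ring_1) mpoly mat" where
  "hankel N = mat N N (\<lambda>(i, j). power_sum (Suc (i + j)))"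

lemma hankel_carrier: "hankel N \<in> carrier_mat N N"
  by (simp add: hankel_def)

text \<open>The monomial \<open>x\<^sub>1 x\<^sub>2\<^sup>3 x\<^sub>3\<^sup>5 \<dots>\<close> occurs exactly once in the expansion, with coefficient 1: it
  has \<open>N\<close> distinct variables, so each of the \<open>N\<close> power sums contributes a different one.\<close>

lemma regular_det_hankel:
  assumes "N \<le> CARD('n::finite)"
  shows "regular (det (hankel N :: ('n, 'a::comm_ring_1) mpoly mat))"
proof -
  define U where "U = {0..<N}"
  obtain h0 :: "nat \<Rightarrow> 'n" where h0: "bij_betw h0 {0..<CARD('n)} UNIV"
    using ex_bij_betw_nat_finite[OF finite, of "UNIV :: 'n set"] by blast
  \<comment> \<open>Restriction makes \<open>h\<close> an element of
    \<open>U \<rightarrow>\<^sub>E UNIV\<close>, so agreement with \<open>h\<close> on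
    \<open>U\<close> becomes equality of functions there.\<close>
  define h where "h = restrict h0 U"
  have h: "inj_on h U"
    using inj_on_subset[OF bij_betw_imp_inj_on[OF h0], of U] assms by (auto simp: h_def U_def inj_on_def)
  define M where "M = (\<Sum>i\<in>U. Poly_Mapping.single (h i) (Suc (2 * i)))"
  \<comment> \<open>The exponent obtained from the Leibniz term of \<open>p\<close> when the
    variable \<open>f i\<close> is chosen in the power sum of row \<open>i\<close>.\<close>
  define m where "m p f = (\<Sum>i\<in>U. Poly_Mapping.single (f i) (Suc (i + p i)))" for p and f :: "nat \<Rightarrow> 'n"
  have m: "m p f = M \<longleftrightarrow> p = id \<and> f = h" if "p permutes U" "f \<in> U \<rightarrow>\<^sub>E UNIV" for p f
  proof
    assume "m p f = M"
    then have "p = id \<and> (\<forall>i\<in>U. f i = h i)"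
      unfolding m_def M_def U_def using that(1) h by (intro hankel_monomial_unique) (auto simp: U_def)
    moreover have "h \<in> U \<rightarrow>\<^sub>E UNIV"
      by (simp add: h_def)
    ultimately show "p = id \<and> f = h"
      using that(2) by (auto intro: PiE_ext)
  qed (simp add: m_def M_def mult_2)
  have "det (hankel N :: ('n, 'a) mpoly mat) =
      (\<Sum>p | p permutes U. signof p * (\<Prod>i\<in>U. power_sum (Suc (i + p i))))"
    unfolding det_def'[OF hankel_carrier] U_def
    by (intro sum.cong arg_cong2[of _ _ _ _ "(*)"] prod.cong) (auto simp: hankel_def permutes_in_image)
  also have "\<dots> = (\<Sum>p | p permutes U. \<Sum>f\<in>U \<rightarrow>\<^sub>E UNIV. Const (signof p) * Poly_Mapping.single (m p f) 1)"
  proof (rule sum.cong)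
    fix p :: "nat \<Rightarrow> nat"
    have "(\<Prod>i\<in>U. power_sum (Suc (i + p i)) :: ('n, 'a) mpoly) =
        (\<Sum>f\<in>U \<rightarrow>\<^sub>E UNIV. \<Prod>i\<in>U. Var (f i) ^ Suc (i + p i))"
      unfolding power_sum_def by (rule prod_sum_PiE) (auto simp: U_def)
    also have "\<dots> = (\<Sum>f\<in>U \<rightarrow>\<^sub>E UNIV. Poly_Mapping.single (m p f) 1)"
      unfolding Var_power prod_single_1 m_def ..
    finally have *: "(\<Prod>i\<in>U. power_sum (Suc (i + p i)) :: ('n, 'a) mpoly) =
      (\<Sum>f\<in>U \<rightarrow>\<^sub>E UNIV. Poly_Mapping.single (m p f) 1)" .
    \<comment> \<open>As a constant, the sign can be pulled out of coefficients by
      \<open>lookup_Const_mult\<close>.\<close>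
    have "signof p = (Const (signof p) :: ('n, 'a) mpoly)"
      by (simp add: sign_def Const_simps)
    then show "signof p * (\<Prod>i\<in>U. power_sum (Suc (i + p i))) =
        (\<Sum>f\<in>U \<rightarrow>\<^sub>E UNIV. Const (signof p) * Poly_Mapping.single (m p f) (1 :: 'a))"
      unfolding * by (metis (no_types) sum_distrib_left)
  qed simp
  also have "Poly_Mapping.lookup \<dots> M =
      (\<Sum>p | p permutes U. \<Sum>f\<in>U \<rightarrow>\<^sub>E UNIV. signof p * (1 when m p f = M))"
    unfolding lookup_sum lookup_Const_mult lookup_single ..
  also have "\<dots> = (\<Sum>p | p permutes U. if p = id then 1 else 0)"
  proof (rule sum.cong)
    fix p assume "p \<in> {p. p permutes U}"
    then have "(\<Sum>f\<in>U \<rightarrow>\<^sub>E UNIV. signof p * (1 when m p f = M)) =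
        (\<Sum>f\<in>U \<rightarrow>\<^sub>E UNIV. if f = h then if p = id then 1 else 0 else (0 :: 'a))"
      by (intro sum.cong) (auto simp: m when_def)
    moreover have "finite (U \<rightarrow>\<^sub>E (UNIV :: 'n set))" "h \<in> U \<rightarrow>\<^sub>E UNIV"
      by (auto simp: U_def h_def intro: finite_PiE)
    ultimately show "(\<Sum>f\<in>U \<rightarrow>\<^sub>E UNIV. signof p * (1 when m p f = M)) = (if p = id then 1 else (0 :: 'a))"
      by simp
  qed simp
  also have "\<dots> = 1"
    by (simp add: U_def finite_permutations permutes_id)
  finally show ?thesis
    by (rule regular_if_coeff_1)
qed


section \<open>Elementary symmetric polynomials and power sums\<close>

text \<open>The last term of Newton's identity of degree \<open>k\<close> is
  \<open>power_sum k\<close> up to sign, since \<open>elem_sym 0 = 1\<close>; induction needs no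
  division.\<close>

lemma power_sum_in_adjoin_elem_sym:
  "k > 0 \<Longrightarrow> (power_sum k :: ('n::finite, 'a::comm_ring_1) mpoly) \<in> adjoin (elem_sym ` {1..CARD('n)})"
proof (induction k rule: less_induct)
  case (less k)
  then obtain l where k: "k = Suc l"
    using gr0_implies_Suc by blast
  let ?A = "adjoin (elem_sym ` {1..CARD('n)}) :: ('n, 'a) mpoly set"
  have e: "elem_sym j \<in> ?A" for j
  proof (cases "j = 0 \<or> j > CARD('n)")
    case True
    then show ?thesis
      by (auto simp: elem_sym_0 elem_sym_eq_0 adjoin_0 adjoin_1)
  next
    case False
    then show ?thesis
      by (intro adjoin.gen imageI) auto
  qed
  define S where "S = (\<Sum>j<l. (- 1) ^ j * elem_sym (k - 1 - j) * power_sum (Suc j) :: ('n, 'a) mpoly)"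
  have "of_nat k * elem_sym k - S = (- 1) ^ l * power_sum k"
    unfolding newton_identity S_def by (simp add: k elem_sym_0)
  then have "power_sum k = (- 1) ^ l * (of_nat k * elem_sym k + - S)"
    by (simp add: left_minus_one_mult_self)
  moreover have "S \<in> ?A"
    unfolding S_def using less.IH by (intro adjoin_sum adjoin.mult adjoin_minus_1_power e) (simp add: k)
  moreover have "of_nat k \<in> ?A"
    using adjoin.Const[of "of_nat k"] by (simp add: Const_simps)
  ultimately show ?case
    by (metis adjoin.add adjoin.mult adjoin_minus_1_power adjoin_uminus e)
qed

text \<open>Newton's identity of degree \<open>k\<close> is divided by \<open>k\<close>, a unit for
  \<open>0 < k < r\<close>; it involves only power sums of index at most
  \<open>k \<le> K\<close>.\<close>

lemma elem_sym_in_adjoin_power_sum: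
  assumes "\<And>j. 0 < j \<Longrightarrow> j < r \<Longrightarrow> (of_nat j :: 'a::comm_ring_1) dvd 1" "r \<le> Suc K" "k < r"
  shows "(elem_sym k :: ('n::finite, 'a) mpoly) \<in> adjoin (power_sum ` {1..K})"
  using assms(3)
proof (induction k rule: less_induct)
  case (less k)
  show ?case
  proof (cases "k = 0")
    case True
    then show ?thesis
      by (simp add: elem_sym_0 adjoin_1)
  next
    case False
    then obtain u where u: "1 = of_nat k * (u :: 'a)"
      using assms(1)[of k] less.prems by (auto elim: dvdE)
    have "elem_sym k = Const (of_nat k * u) * (elem_sym k :: ('n, 'a) mpoly)"
      unfolding u[symmetric] by (simp add: Const_simps)
    also have "\<dots> = Const u * (\<Sum>j<k. (- 1) ^ j * elem_sym (k - 1 - j) * power_sum (Suc j))"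
      unfolding newton_identity[symmetric] by (simp add: Const_simps ac_simps)
    also have "\<dots> \<in> adjoin (power_sum ` {1..K})"
      using less assms(2)
      by (intro adjoin.mult adjoin.Const adjoin_sum adjoin_minus_1_power) (auto intro: adjoin.gen)
    finally show ?thesis .
  qed
qed

text \<open>The Newton identities of degrees \<open>n + 1, \<dots>, 2 n + 1 - r\<close> form a linear system with Hankel
  matrix for the unknowns \<open>(- 1)\<^sup>j e\<^sub>j\<close>, \<open>r \<le> j \<le> n\<close>, listed in decreasing order of \<open>j\<close>.\<close>

lemma det_hankel_mult_elem_sym:
  fixes r :: nat
  defines "F \<equiv> (power_sum :: nat \<Rightarrow> ('n::finite, 'a::comm_ring_1) mpoly) ` {1..2 * CARD('n) + 1 - r}"
  assumes r: "0 < r" "r \<le> CARD('n)" and low: "\<And>k. k < r \<Longrightarrow> elem_sym k \<in> adjoin F"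
    and k: "r \<le> k" "k \<le> CARD('n)"
  shows "det (hankel (CARD('n) + 1 - r)) * elem_sym k \<in> adjoin F"
proof -
  define n where "n = CARD('n)"
  define N where "N = n + 1 - r"
  note r = r[folded n_def] and k = k[folded n_def]
  define c :: "nat \<Rightarrow> ('n, 'a) mpoly" where "c j = (- 1) ^ j * elem_sym j" for j
  \<comment> \<open>Listing the unknowns backwards turns the index \<open>n + 1 + a - j\<close> into
    \<open>Suc (a + b)\<close> for \<open>j = n - b\<close>, which makes the matrix Hankel.\<close>
  define v where "v = vec N (\<lambda>b. c (n - b))"
  have F: "power_sum j \<in> adjoin F" if "0 < j" "j \<le> 2 * n + 1 - r" for j
    using that by (auto simp: F_def n_def intro!: adjoin.gen)
  have entries: "hankel N $$ (i, j) \<in> adjoin F" if "i < N" "j < N" for i j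
    using that r by (auto simp: hankel_def N_def intro!: F)
  have rhs: "(hankel N *\<^sub>v v) $ a \<in> adjoin F" if a: "a < N" for a
  proof -
    have "(hankel N *\<^sub>v v) $ a = (\<Sum>b\<in>{0..<N}. power_sum (Suc (a + b)) * c (n - b))"
      using a by (simp add: hankel_def v_def scalar_prod_def)
    also have "\<dots> = (\<Sum>j\<in>{r..n}. c j * power_sum (n + 1 + a - j))"
      using r by (intro sum.reindex_bij_witness[of _ "\<lambda>j. n - j" "\<lambda>b. n - b"])
        (auto simp: N_def mult.commute intro!: arg_cong2[of _ _ _ _ "(*)"] arg_cong[of _ _ power_sum])
    finally have lhs: "(hankel N *\<^sub>v v) $ a = (\<Sum>j\<in>{r..n}. c j * power_sum (n + 1 + a - j))" .
    have "0 = (\<Sum>j\<le>n. c j * power_sum (n + 1 + a - j))"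
      using newton_identity_above[where ?'n = 'n and ?'a = 'a, of "n + 1 + a"]
      by (simp add: c_def n_def)
    also have "{..n} = {..<r} \<union> {r..n}"
      using r by auto
    also have "(\<Sum>j\<in>\<dots>. c j * power_sum (n + 1 + a - j)) =
        (\<Sum>j<r. c j * power_sum (n + 1 + a - j)) + (\<Sum>j\<in>{r..n}. c j * power_sum (n + 1 + a - j))"
      by (rule sum.union_disjoint) auto
    finally have "(hankel N *\<^sub>v v) $ a = - (\<Sum>j<r. c j * power_sum (n + 1 + a - j))"
      unfolding lhs by (simp only: eq_neg_iff_add_eq_0 add.commute)
    \<comment> \<open>The largest index occurs at \<open>j = 0\<close>, \<open>a = N - 1\<close> and
      equals \<open>2 * n + 1 - r\<close>: this fixes how many power sums are taken.\<close>
    also have "\<dots> \<in> adjoin F"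
      unfolding c_def using a r
      by (intro adjoin_uminus adjoin_sum adjoin.mult adjoin_minus_1_power low F) (auto simp: N_def)
    finally show ?thesis .
  qed
  have "det (hankel N) * v $ (n - k) \<in> adjoin F"
    using k r by (intro adjoin_det_mult[OF hankel_carrier _ entries rhs]) (auto simp: v_def N_def)
  also have "v $ (n - k) = c k"
    using k r by (simp add: v_def N_def)
  finally have "(- 1) ^ k * (det (hankel N) * c k) \<in> adjoin F"
    by (rule adjoin.mult[OF adjoin_minus_1_power])
  also have "(- 1) ^ k * (det (hankel N) * c k) = det (hankel N) * elem_sym k"
    by (simp add: c_def mult.left_commute[of "det (hankel N)"] left_minus_one_mult_self)
  finally show ?thesis
    by (simp add: N_def n_def)
qed

theorem theorem2p8:
  fixes r0 :: nat
  assumes "\<exists>m::nat. m > 0 \<and> \<not> (of_nat m :: 'a::comm_ring_1) dvd 1"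
    and "r0 = (LEAST m::nat. m > 0 \<and> \<not> (of_nat m :: 'a) dvd 1)"
    and "CARD('n) \<ge> r0"
  shows "adjoin_frac ((elem_sym :: nat \<Rightarrow> ('n::finite, 'a) mpoly) ` {1..CARD('n)}) =
         adjoin_frac ((power_sum :: nat \<Rightarrow> ('n, 'a) mpoly) ` {1..2 * CARD('n) + 1 - r0})"
proof -
  have r0: "r0 > 0"
    using LeastI_ex[OF assms(1)] assms(2) by simp
  \<comment> \<open>Minimality of \<open>r0\<close>.\<close>
  have units: "(of_nat j :: 'a) dvd 1" if "0 < j" "j < r0" for j
    using not_less_Least[of j "\<lambda>m. m > 0 \<and> \<not> (of_nat m :: 'a) dvd 1"] that assms(2) by auto
  define F where "F = (power_sum :: nat \<Rightarrow> ('n, 'a) mpoly) ` {1..2 * CARD('n) + 1 - r0}"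
  have low: "elem_sym k \<in> adjoin F" if "k < r0" for k
    unfolding F_def using units that assms(3) by (intro elem_sym_in_adjoin_power_sum[of r0]) auto
  let ?d = "det (hankel (CARD('n) + 1 - r0)) :: ('n, 'a) mpoly"
  have d: "?d \<in> adjoin F"
    using r0 assms(3)
    by (intro adjoin_det[OF hankel_carrier]) (auto simp: hankel_def F_def intro!: adjoin.gen)
  show ?thesis
    unfolding F_def[symmetric]
  proof (rule adjoin_frac_eqI)
    show "F \<subseteq> adjoin (elem_sym ` {1..CARD('n)})"
      unfolding F_def by (intro image_subsetI power_sum_in_adjoin_elem_sym) simp
    show "?d \<in> adjoin F"
      by (fact d)
    \<comment> \<open>The matrix has size at most \<open>CARD('n)\<close> because
      \<open>r0 \<ge> 1\<close>, so there are enough variables.\<close>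
    show "regular ?d"
      using r0 by (intro regular_det_hankel) auto
    fix g assume "g \<in> (elem_sym :: nat \<Rightarrow> ('n, 'a) mpoly) ` {1..CARD('n)}"
    then obtain k where k: "g = elem_sym k" "k \<le> CARD('n)"
      by auto
    show "?d * g \<in> adjoin F"
    proof (cases "k < r0")
      case True
      then show ?thesis
        unfolding k(1) by (intro adjoin.mult d low)
    next
      case False
      then show ?thesis
        unfolding k(1) F_def using r0 assms(3) k(2) low
        by (intro det_hankel_mult_elem_sym) (auto simp: F_def)
    qed
  qed
qed

end
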